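(* Let $(n,E)$ be a (smooth) solution of $-\Box n=\Delta|E|^2$, $-\Box E+E=-nE$ on $\mathbb{R}^{1+2}$, with $n$ real-valued and $E$ $\mathbb{R}^2$-valued, and let $$\widetilde n=n+\tfrac14\Delta|E|^2 .$$ Then $$\begin{aligned}-\Box\widetilde n=\;&\tfrac12\big(-\Box\Delta E+\Delta E\big)\cdot E+\tfrac32\,\Delta E\cdot\big(-\Box E+E\big)+\tfrac32\big(-\Box\partial^aE+\partial^aE\big)\cdot\partial_aE\\&+\tfrac12\,\partial^aE\cdot\big(-\Box\partial_aE+\partial_aE\big)-Q_{a\beta}(\partial^\beta\partial^aE,E)-Q_{\beta a}(\partial^aE,\partial^\beta E).\end{aligned}$$
   Context: $\mathbb{R}^{1+2}$ has metric $\mathrm{diag}(-1,1,1)$ and coordinates $(x^0,x^1,x^2)=(t,x_1,x_2)$; indices are raised and lowered with this metric and repeated upper/lower indices are summed, Greek indices over $\{0,1,2\}$ and Roman indices over $\{1,2\}$. $\Box=\partial_\alpha\partial^\alpha=-\partial_t^2+\Delta$, $\Delta=\partial_a\partial^a$. $Q_{\alpha\beta}(f,g)=\partial_\alpha f\cdot\partial_\beta g-\partial_\beta f\cdot\partial_\alpha g$, where $\cdot$ is the Euclidean inner product of $\mathbb{R}^2$-valued functions. *)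

theory Defs
  imports "HOL-Analysis.Analysis"
begin

text \<open>
  A point of \<open>\<real>\<^sup>1\<^sup>+\<^sup>2\<close> is an element \<open>x\<close> of \<^typ>\<open>real ^ 3\<close> with coordinates
  \<open>(t, x\<^sub>1, x\<^sub>2) = (x $ 0, x $ 1, x $ 2)\<close>; the index type \<^typ>\<open>3\<close> consists of
  exactly \<open>0\<close>, \<open>1\<close>, \<open>2\<close> (its numeral \<open>3\<close> denotes \<open>0\<close>).  Greek indices range over all
  of \<^typ>\<open>3\<close>, Roman indices over \<open>{1, 2}\<close>.
\<close>

type_synonym spacetime = "real ^ 3"

abbreviation roman :: "3 set" where
  "roman \<equiv> {1, 2}"

text \<open>The matrix \<open>diag (-1, 1, 1)\<close> is its own inverse, so it represents the metric with lower
  as well as with upper indices.\<close>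

definition metric :: "real ^ 3 ^ 3" where
  "metric = (\<chi> \<alpha> \<beta>. if \<alpha> = \<beta> then (if \<alpha> = 0 then - 1 else 1) else 0)"

definition pd :: "3 \<Rightarrow> (spacetime \<Rightarrow> 'a::real_normed_vector) \<Rightarrow> spacetime \<Rightarrow> 'a" where
  "pd \<alpha> f x = vector_derivative (\<lambda>s. f (x + s *\<^sub>R axis \<alpha> 1)) (at 0)"

definition pd_up :: "3 \<Rightarrow> (spacetime \<Rightarrow> 'a::real_normed_vector) \<Rightarrow> spacetime \<Rightarrow> 'a" where
  "pd_up \<alpha> f x = (\<Sum>\<beta>\<in>UNIV. metric $ \<alpha> $ \<beta> *\<^sub>R pd \<beta> f x)"

definition dalembert :: "(spacetime \<Rightarrow> 'a::real_normed_vector) \<Rightarrow> spacetime \<Rightarrow> 'a" where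
  "dalembert f x = (\<Sum>\<alpha>\<in>UNIV. pd \<alpha> (pd_up \<alpha> f) x)"

definition lap :: "(spacetime \<Rightarrow> 'a::real_normed_vector) \<Rightarrow> spacetime \<Rightarrow> 'a" where
  "lap f x = (\<Sum>a\<in>roman. pd a (pd_up a f) x)"

definition Q :: "3 \<Rightarrow> 3 \<Rightarrow> (spacetime \<Rightarrow> real ^ 2) \<Rightarrow> (spacetime \<Rightarrow> real ^ 2) \<Rightarrow> spacetime \<Rightarrow> real" where
  "Q \<alpha> \<beta> f g x = pd \<alpha> f x \<bullet> pd \<beta> g x - pd \<beta> f x \<bullet> pd \<alpha> g x"

text \<open>\<open>C\<^sup>\<infinity>\<close> on the whole space: the iterated partial derivatives of all orders exist and are
  continuous.  The explicit existence clause is needed because \<^const>\<open>vector_derivative\<close> is total.\<close>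

definition smooth :: "(spacetime \<Rightarrow> 'a::real_normed_vector) \<Rightarrow> bool" where
  "smooth f \<longleftrightarrow>
    (\<forall>\<alpha>s :: 3 list.
      continuous_on UNIV (foldr pd \<alpha>s f) \<and>
      (\<forall>\<alpha> x. (\<lambda>s. foldr pd \<alpha>s f (x + s *\<^sub>R axis \<alpha> 1)) differentiable (at 0)))"

definition n_tilde :: "(spacetime \<Rightarrow> real) \<Rightarrow> (spacetime \<Rightarrow> real ^ 2) \<Rightarrow> spacetime \<Rightarrow> real" where
  "n_tilde n E x = n x + 1 / 4 * lap (\<lambda>y. (norm (E y))\<^sup>2) x"

end

theory Submission
  imports Defs
begin

text \<open>
  By the wave equation, the box operator applied to \<open>n_tilde n E\<close> only involves
  \<open>N = E \<bullet> E\<close>: the left-hand side is \<open>lap N - 1/4 * dalembert (lap N)\<close>.  Both sides are then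
  expanded by the Leibniz rule into inner products of iterated partial derivatives of \<open>E\<close>.
  Up to the symmetry of mixed partial derivatives they agree: summed over the indices, the first
  null form contributes \<open>\<partial>\<^sub>\<beta> \<Delta>E \<bullet> \<partial>\<^sup>\<beta> E - \<box>\<partial>\<^sup>a E \<bullet> \<partial>\<^sub>a E\<close>
  and the second \<open>\<partial>\<^sub>\<beta> \<partial>\<^sup>a E \<bullet> \<partial>\<^sub>a \<partial>\<^sup>\<beta> E - \<Delta>E \<bullet> \<box>E\<close>.
\<close>

section \<open>Closure properties of smooth functions and the Leibniz rule\<close>

lemma smooth_continuous: "smooth f \<Longrightarrow> continuous_on UNIV f"
  unfolding smooth_def by (metis foldr.simps(1) id_apply)

lemma smooth_pd: "smooth f \<Longrightarrow> smooth (pd \<alpha> f)"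
  unfolding smooth_def
proof (intro allI)
  fix \<alpha>s
  assume *: "\<forall>\<alpha>s. continuous_on UNIV (foldr pd \<alpha>s f) \<and>
      (\<forall>\<alpha> x. (\<lambda>s. foldr pd \<alpha>s f (x + s *\<^sub>R axis \<alpha> 1)) differentiable at 0)"
  show "continuous_on UNIV (foldr pd \<alpha>s (pd \<alpha> f)) \<and>
      (\<forall>\<alpha>' x. (\<lambda>s. foldr pd \<alpha>s (pd \<alpha> f) (x + s *\<^sub>R axis \<alpha>' 1)) differentiable at 0)"
    \<comment> \<open>\<open>foldr\<close> applies the last list element first, so appending
      \<open>\<alpha>\<close> makes it the innermost derivative.\<close>
    using *[rule_format, of "\<alpha>s @ [\<alpha>]"] by simp
qed

lemma smooth_has_pd_at_0:
  assumes "smooth f"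
  shows "((\<lambda>s. f (x + s *\<^sub>R axis \<alpha> 1)) has_vector_derivative pd \<alpha> f x) (at 0)"
proof -
  have "(\<lambda>s. foldr pd [] f (x + s *\<^sub>R axis \<alpha> 1)) differentiable at 0"
    using assms unfolding smooth_def by blast
  then show ?thesis
    by (simp add: pd_def vector_derivative_works)
qed

text \<open>Moving the base point along the line, via the reparametrization \<open>s - t\<close>,
  carries differentiability at \<open>0\<close> to every parameter \<open>t\<close>, as the mean
  value theorem requires.\<close>

lemma smooth_has_pd:
  assumes "smooth f"
  shows "((\<lambda>s. f (x + s *\<^sub>R axis \<alpha> 1)) has_vector_derivative pd \<alpha> f (x + t *\<^sub>R axis \<alpha> 1)) (at t)"
proof -
  have "((\<lambda>s. s - t) has_vector_derivative 1) (at t)"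
    by (auto intro!: derivative_eq_intros)
  moreover have "((\<lambda>s. f (x + t *\<^sub>R axis \<alpha> 1 + s *\<^sub>R axis \<alpha> 1))
      has_vector_derivative pd \<alpha> f (x + t *\<^sub>R axis \<alpha> 1)) (at (t - t))"
    using smooth_has_pd_at_0[OF assms] by simp
  ultimately have "((\<lambda>s. f (x + t *\<^sub>R axis \<alpha> 1 + s *\<^sub>R axis \<alpha> 1)) \<circ> (\<lambda>s. s - t)
      has_vector_derivative 1 *\<^sub>R pd \<alpha> f (x + t *\<^sub>R axis \<alpha> 1)) (at t)"
    by (rule vector_diff_chain_at)
  then show ?thesis
    by (simp add: o_def algebra_simps)
qed

text \<open>If \<open>S\<close> is closed under \<open>pd\<close>, all iterated derivatives of
  \<open>f\<close> stay in \<open>S\<close>. Smoothness thus follows from first-order facts about a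
  suitable invariant, without formulas for higher derivatives.\<close>

lemma smooth_coinduct:
  assumes "f \<in> S"
    and cont: "\<And>g. g \<in> S \<Longrightarrow> continuous_on UNIV g"
    and diff: "\<And>g \<alpha> x. g \<in> S \<Longrightarrow> (\<lambda>s. g (x + s *\<^sub>R axis \<alpha> 1)) differentiable (at 0)"
    and pd: "\<And>g \<alpha>. g \<in> S \<Longrightarrow> pd \<alpha> g \<in> S"
  shows "smooth f"
proof -
  have "foldr pd \<alpha>s f \<in> S" for \<alpha>s
    by (induction \<alpha>s) (use assms(1) pd in auto)
  then show ?thesis
    using cont diff by (auto simp: smooth_def)
qed

text \<open>One rule for negation, scaling by a constant and pairing with a fixed vector.\<close>

lemma pd_bounded_linear:
  assumes "bounded_linear L" "smooth f"
  shows "pd \<alpha> (\<lambda>x. L (f x)) = (\<lambda>x. L (pd \<alpha> f x))"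
  unfolding pd_def[of _ "\<lambda>x. L (f x)"]
  by (intro ext vector_derivative_at bounded_linear.has_vector_derivative[OF assms(1)]
      smooth_has_pd_at_0 assms)

lemma smooth_bounded_linear:
  assumes "bounded_linear L" "smooth f"
  shows "smooth (\<lambda>x. L (f x))"
proof (rule smooth_coinduct[of _ "{\<lambda>x. L (g x) | g. smooth g}"])
  show "(\<lambda>x. L (f x)) \<in> {\<lambda>x. L (g x) | g. smooth g}"
    using assms by blast
next
  fix h assume "h \<in> {\<lambda>x. L (g x) | g. smooth g}"
  then obtain g where g: "smooth g" "h = (\<lambda>x. L (g x))" by blast
  show "continuous_on UNIV h"
    using g assms(1) by (simp add: bounded_linear.continuous_on smooth_continuous)
  show "(\<lambda>s. h (x + s *\<^sub>R axis \<alpha> 1)) differentiable at 0" for \<alpha> x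
    unfolding g(2)
    by (rule differentiableI_vector
        bounded_linear.has_vector_derivative[OF assms(1)] smooth_has_pd_at_0 g(1))+
  show "pd \<alpha> h \<in> {\<lambda>x. L (g x) | g. smooth g}" for \<alpha>
    using g pd_bounded_linear[OF assms(1)] smooth_pd by blast
qed

lemma pd_add:
  assumes "smooth f" "smooth g"
  shows "pd \<alpha> (\<lambda>x. f x + g x) = (\<lambda>x. pd \<alpha> f x + pd \<alpha> g x)"
  unfolding pd_def[of _ "\<lambda>x. f x + g x"]
  by (intro ext vector_derivative_at has_vector_derivative_add smooth_has_pd_at_0 assms)

lemma smooth_add:
  assumes "smooth f" "smooth g"
  shows "smooth (\<lambda>x. f x + g x)"
proof (rule smooth_coinduct[of _ "{\<lambda>x. f x + g x | f g. smooth f \<and> smooth g}"])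
  show "(\<lambda>x. f x + g x) \<in> {\<lambda>x. f x + g x | f g. smooth f \<and> smooth g}"
    using assms by blast
next
  fix h :: "spacetime \<Rightarrow> 'a" assume "h \<in> {\<lambda>x. f x + g x | f g. smooth f \<and> smooth g}"
  then obtain f g where fg: "smooth f" "smooth g" "h = (\<lambda>x. f x + g x)" by blast
  show "continuous_on UNIV h"
    using fg by (simp add: continuous_on_add smooth_continuous)
  show "(\<lambda>s. h (x + s *\<^sub>R axis \<alpha> 1)) differentiable at 0" for \<alpha> x
    unfolding fg(3)
    by (rule differentiableI_vector has_vector_derivative_add smooth_has_pd_at_0 fg)+
  show "pd \<alpha> h \<in> {\<lambda>x. f x + g x | f g. smooth f \<and> smooth g}" for \<alpha>
    using fg pd_add smooth_pd by blast
qed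

lemma has_pd_inner:
  fixes f g :: "spacetime \<Rightarrow> 'a::real_inner"
  assumes "smooth f" "smooth g"
  shows "((\<lambda>s. f (x + s *\<^sub>R axis \<alpha> 1) \<bullet> g (x + s *\<^sub>R axis \<alpha> 1))
      has_vector_derivative f x \<bullet> pd \<alpha> g x + pd \<alpha> f x \<bullet> g x) (at 0)"
  using bounded_bilinear.has_vector_derivative[OF bounded_bilinear_inner
      smooth_has_pd_at_0[OF assms(1)] smooth_has_pd_at_0[OF assms(2)], of x \<alpha> x \<alpha>]
  by simp

lemma pd_inner:
  fixes f g :: "spacetime \<Rightarrow> 'a::real_inner"
  assumes "smooth f" "smooth g"
  shows "pd \<alpha> (\<lambda>x. f x \<bullet> g x) = (\<lambda>x. f x \<bullet> pd \<alpha> g x + pd \<alpha> f x \<bullet> g x)"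
  unfolding pd_def[of _ "\<lambda>x. f x \<bullet> g x"]
  by (intro ext vector_derivative_at has_pd_inner assms)

text \<open>The invariant for the smoothness of inner products: single products are not closed under
  partial derivatives, but finite sums of them are.  The parameter \<open>T\<close> only records the type of
  the factors.\<close>

inductive inner_sum :: "'a::real_inner itself \<Rightarrow> (spacetime \<Rightarrow> real) \<Rightarrow> bool" for T :: "'a::real_inner itself" where
  inner: "smooth f \<Longrightarrow> smooth g \<Longrightarrow> inner_sum T (\<lambda>x. (f x :: 'a::real_inner) \<bullet> g x)"
| add: "inner_sum T f \<Longrightarrow> inner_sum T g \<Longrightarrow> inner_sum T (\<lambda>x. f x + g x)"

lemma inner_sum_step:
  assumes "inner_sum T h"
  shows "continuous_on UNIV h \<and> (\<forall>\<alpha> x. (\<lambda>s. h (x + s *\<^sub>R axis \<alpha> 1)) differentiable at 0) \<and>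
    (\<forall>\<alpha>. inner_sum T (pd \<alpha> h))"
  using assms
proof induction
  case (inner f g)
  have "continuous_on UNIV (\<lambda>x. f x \<bullet> g x)"
    by (intro continuous_on_inner smooth_continuous inner)
  moreover have "inner_sum T (pd \<alpha> (\<lambda>x. f x \<bullet> g x))" for \<alpha>
    unfolding pd_inner[OF inner]
    by (rule inner_sum.add) (intro inner_sum.inner smooth_pd inner)+
  ultimately show ?case
    using has_pd_inner[OF inner] by (blast intro: differentiableI_vector)
next
  case (add f g)
  then have "pd \<alpha> (\<lambda>x. f x + g x) = (\<lambda>x. pd \<alpha> f x + pd \<alpha> g x)" for \<alpha>
    by (auto simp: pd_def vector_derivative_works
        intro!: ext vector_derivative_at has_vector_derivative_add)
  with add show ?case
    by (auto intro!: continuous_on_add derivative_intros inner_sum.add)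
qed

lemma smooth_inner:
  fixes f g :: "spacetime \<Rightarrow> 'a::real_inner"
  assumes "smooth f" "smooth g"
  shows "smooth (\<lambda>x. f x \<bullet> g x)"
  by (rule smooth_coinduct[of _ "Collect (inner_sum TYPE('a))"])
    (use assms inner_sum_step[of "TYPE('a)"] in \<open>auto intro: inner_sum.inner\<close>)

section \<open>Symmetry of second partial derivatives\<close>

lemma smooth_mean_value:
  fixes f :: "spacetime \<Rightarrow> real"
  assumes "smooth f" "0 < h"
  obtains t where "0 < t" "t < h"
    "f (x + h *\<^sub>R axis \<alpha> 1) - f x = h * pd \<alpha> f (x + t *\<^sub>R axis \<alpha> 1)"
proof -
  have "\<exists>t. 0 < t \<and> t < h \<and> f (x + h *\<^sub>R axis \<alpha> 1) - f (x + 0 *\<^sub>R axis \<alpha> 1)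
      = (h - 0) * pd \<alpha> f (x + t *\<^sub>R axis \<alpha> 1)"
    by (rule MVT2) (use assms smooth_has_pd in
        \<open>auto simp: has_real_derivative_iff_has_vector_derivative\<close>)
  then show thesis using that by auto
qed

lemma smooth_diff:
  "smooth f \<Longrightarrow> smooth g \<Longrightarrow> smooth (\<lambda>x. f x - g x)"
  using smooth_add[OF _ smooth_bounded_linear[OF bounded_linear_minus[OF bounded_linear_ident]]]
  by fastforce

lemma pd_diff:
  assumes "smooth f" "smooth g"
  shows "pd \<alpha> (\<lambda>x. f x - g x) = (\<lambda>x. pd \<alpha> f x - pd \<alpha> g x)"
  unfolding pd_def[of _ "\<lambda>x. f x - g x"]
  by (intro ext vector_derivative_at has_vector_derivative_diff smooth_has_pd_at_0 assms)

lemma smooth_translate: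
  assumes "smooth f"
  shows "smooth (\<lambda>x. f (x + v))" "pd \<alpha> (\<lambda>x. f (x + v)) = (\<lambda>x. pd \<alpha> f (x + v))"
proof -
  have pd: "pd \<alpha> (\<lambda>x. f (x + v)) = (\<lambda>x. pd \<alpha> f (x + v))" for f :: "spacetime \<Rightarrow> 'a" and \<alpha>
    by (auto simp: pd_def fun_eq_iff algebra_simps)
  show "pd \<alpha> (\<lambda>x. f (x + v)) = (\<lambda>x. pd \<alpha> f (x + v))" by (rule pd)
  show "smooth (\<lambda>x. f (x + v))"
  proof (rule smooth_coinduct[of _ "{\<lambda>x. g (x + v) | g. smooth g}"])
    fix h :: "spacetime \<Rightarrow> 'a" assume "h \<in> {\<lambda>x. g (x + v) | g. smooth g}"
    then obtain g where g: "smooth g" "h = (\<lambda>x. g (x + v))" by blast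
    show "continuous_on UNIV h"
      unfolding g(2) by (rule continuous_on_compose2[OF smooth_continuous[OF g(1)]])
        (auto intro!: continuous_intros)
    show "(\<lambda>s. h (x + s *\<^sub>R axis \<alpha> 1)) differentiable at 0" for \<alpha> x
      using differentiableI_vector[OF smooth_has_pd_at_0[OF g(1), of "x + v" \<alpha>]]
      by (simp add: g(2) algebra_simps)
    show "pd \<alpha> h \<in> {\<lambda>x. g (x + v) | g. smooth g}" for \<alpha>
      using g pd smooth_pd by blast
  qed (use assms in blast)
qed

text \<open>The second difference is symmetric in \<open>\<alpha>\<close> and \<open>\<beta>\<close>, so letting \<open>h\<close> tend to \<open>0\<close>
  gives the symmetry of second partial derivatives.\<close>

lemma second_difference_mean_value:
  fixes f :: "spacetime \<Rightarrow> real"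
  assumes "smooth f" "0 < h"
  obtains y where "dist y x < 2 * h"
    "f (x + h *\<^sub>R axis \<alpha> 1 + h *\<^sub>R axis \<beta> 1) - f (x + h *\<^sub>R axis \<alpha> 1) - f (x + h *\<^sub>R axis \<beta> 1) + f x
      = h * h * pd \<beta> (pd \<alpha> f) y"
proof -
  \<comment> \<open>The second difference is the \<open>\<alpha>\<close>-increment of this
    \<open>\<beta>\<close>-increment. One mean value theorem for \<open>g\<close> along
    \<open>\<alpha>\<close> and one for \<open>pd \<alpha> f\<close> along \<open>\<beta>\<close>
    yield the factor \<open>h * h\<close>.\<close>
  define g where "g = (\<lambda>y. f (y + h *\<^sub>R axis \<beta> 1) - f y)"
  have *: "smooth g"
    unfolding g_def by (intro smooth_diff smooth_translate assms)
  obtain t where t: "0 < t" "t < h" 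
    "g (x + h *\<^sub>R axis \<alpha> 1) - g x = h * pd \<alpha> g (x + t *\<^sub>R axis \<alpha> 1)"
    using smooth_mean_value[OF * assms(2)] .
  have "pd \<alpha> g y = pd \<alpha> f (y + h *\<^sub>R axis \<beta> 1) - pd \<alpha> f y" for y
    unfolding g_def by (simp add: pd_diff smooth_translate assms)
  moreover obtain u where u: "0 < u" "u < h" 
    "pd \<alpha> f (x + t *\<^sub>R axis \<alpha> 1 + h *\<^sub>R axis \<beta> 1) - pd \<alpha> f (x + t *\<^sub>R axis \<alpha> 1)
      = h * pd \<beta> (pd \<alpha> f) (x + t *\<^sub>R axis \<alpha> 1 + u *\<^sub>R axis \<beta> 1)"
    using smooth_mean_value[OF smooth_pd[OF assms(1)] assms(2)] .
  moreover have "norm (t *\<^sub>R axis \<alpha> (1::real) + u *\<^sub>R axis \<beta> 1) \<le> t + u"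
    using norm_triangle_ineq[of "t *\<^sub>R axis \<alpha> (1::real)" "u *\<^sub>R axis \<beta> 1"] t u by simp
  ultimately show thesis
    using t by (intro that[of "x + t *\<^sub>R axis \<alpha> 1 + u *\<^sub>R axis \<beta> 1"])
      (auto simp: g_def dist_norm add.assoc)
qed

lemma pd_commute_real:
  fixes f :: "spacetime \<Rightarrow> real"
  assumes "smooth f"
  shows "pd \<alpha> (pd \<beta> f) x = pd \<beta> (pd \<alpha> f) x"
proof (rule ccontr)
  define F where "F = pd \<alpha> (pd \<beta> f)"
  define G where "G = pd \<beta> (pd \<alpha> f)"
  \<comment> \<open>With half the gap as tolerance, a common value of \<open>F\<close> and
    \<open>G\<close> at points near \<open>x\<close> contradicts the triangle inequality.\<close>
  define e where "e = \<bar>F x - G x\<bar> / 2"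
  assume "pd \<alpha> (pd \<beta> f) x \<noteq> pd \<beta> (pd \<alpha> f) x"
  then have e: "e > 0" by (simp add: e_def F_def G_def)
  have "continuous_on UNIV F" "continuous_on UNIV G"
    unfolding F_def G_def using assms by (auto intro!: smooth_continuous smooth_pd)
  then obtain d1 d2 where d: "d1 > 0" "\<And>y. dist y x < d1 \<Longrightarrow> dist (F y) (F x) < e"
     "d2 > 0" "\<And>y. dist y x < d2 \<Longrightarrow> dist (G y) (G x) < e"
    using e unfolding continuous_on_iff by (metis UNIV_I)
  \<comment> \<open>The intermediate points lie within \<open>2 * h\<close> of \<open>x\<close>,
    hence within both \<open>d1\<close> and \<open>d2\<close>.\<close>
  define h where "h = min d1 d2 / 2"
  have h: "h > 0" using d by (simp add: h_def)
  obtain y where y: "dist y x < 2 * h"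
    "f (x + h *\<^sub>R axis \<alpha> 1 + h *\<^sub>R axis \<beta> 1) - f (x + h *\<^sub>R axis \<alpha> 1) - f (x + h *\<^sub>R axis \<beta> 1) + f x
      = h * h * G y"
    using second_difference_mean_value[OF assms h] unfolding G_def .
  obtain z where z: "dist z x < 2 * h"
    "f (x + h *\<^sub>R axis \<beta> 1 + h *\<^sub>R axis \<alpha> 1) - f (x + h *\<^sub>R axis \<beta> 1) - f (x + h *\<^sub>R axis \<alpha> 1) + f x
      = h * h * F z"
    using second_difference_mean_value[OF assms h] unfolding F_def .
  have "x + h *\<^sub>R axis \<beta> 1 + h *\<^sub>R axis \<alpha> 1 = x + h *\<^sub>R axis \<alpha> 1 + h *\<^sub>R axis \<beta> 1"
    by (simp only: add_ac)
  then have "h * h * F z = h * h * G y"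
    using y(2) z(2) by (simp only:)
  then have "F z = G y" using h by auto
  moreover have "dist (F z) (F x) < e" "dist (G y) (G x) < e"
    using d y(1) z(1) by (auto simp: h_def)
  ultimately show False
    unfolding e_def dist_real_def by (auto simp: abs_if field_simps split: if_splits)
qed

text \<open>Pairing with a constant vector \<open>v\<close> reduces this to the real case, and a
  vector is determined by its inner products with all \<open>v\<close>.\<close>

lemma pd_commute:
  fixes f :: "spacetime \<Rightarrow> 'a::real_inner"
  assumes "smooth f"
  shows "pd \<alpha> (pd \<beta> f) = pd \<beta> (pd \<alpha> f)"
proof
  fix x
  have "pd \<gamma> (pd \<delta> (\<lambda>x. v \<bullet> f x)) x = v \<bullet> pd \<gamma> (pd \<delta> f) x" for v \<gamma> \<delta>
    by (simp add: pd_bounded_linear[OF bounded_linear_inner_right] assms smooth_pd)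
  then have "v \<bullet> pd \<alpha> (pd \<beta> f) x = v \<bullet> pd \<beta> (pd \<alpha> f) x" for v
    using pd_commute_real[OF smooth_bounded_linear[OF bounded_linear_inner_right assms]] by metis
  then show "pd \<alpha> (pd \<beta> f) x = pd \<beta> (pd \<alpha> f) x"
    by (metis inner_commute vector_eq_rdot)
qed

section \<open>The operators in coordinates and the identity\<close>

lemma sum_UNIV_3: "(\<Sum>\<alpha>\<in>UNIV. f (\<alpha> :: 3)) = f 0 + f 1 + f 2"
proof -
  have "(3::3) = 0"
    using of_nat_CHAR[where 'a = 3] by simp
  then show ?thesis
    unfolding sum_3 by (simp only: add_ac)
qed

lemma pd_up_0: "pd_up 0 f = (\<lambda>x. - pd 0 f x)"
  and pd_up_1: "pd_up 1 f = pd 1 f"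
  and pd_up_2: "pd_up 2 f = pd 2 f"
  by (simp_all add: fun_eq_iff pd_up_def sum_UNIV_3 metric_def)

lemma pd_uminus: "smooth f \<Longrightarrow> pd \<alpha> (\<lambda>x. - f x) = (\<lambda>x. - pd \<alpha> f x)"
  by (rule pd_bounded_linear[OF bounded_linear_minus[OF bounded_linear_ident]])

lemma pd_mult_left:
  fixes f :: "spacetime \<Rightarrow> real"
  shows "smooth f \<Longrightarrow> pd \<alpha> (\<lambda>x. c * f x) = (\<lambda>x. c * pd \<alpha> f x)"
  by (rule pd_bounded_linear[OF bounded_linear_mult_right])

lemma dalembert_eq:
  "smooth f \<Longrightarrow> dalembert f = (\<lambda>x. - pd 0 (pd 0 f) x + pd 1 (pd 1 f) x + pd 2 (pd 2 f) x)"
  by (simp add: fun_eq_iff dalembert_def sum_UNIV_3 pd_up_0 pd_up_1 pd_up_2 pd_uminus smooth_pd)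

lemma lap_eq: "lap f = (\<lambda>x. pd 1 (pd 1 f) x + pd 2 (pd 2 f) x)"
  by (simp add: fun_eq_iff lap_def pd_up_1 pd_up_2)

lemma smooth_lap: "smooth f \<Longrightarrow> smooth (lap f)"
  by (simp add: lap_eq smooth_add smooth_pd)

lemma dalembert_add:
  "smooth f \<Longrightarrow> smooth g \<Longrightarrow> dalembert (\<lambda>x. f x + g x) x = dalembert f x + dalembert g x"
  by (simp add: dalembert_eq pd_add smooth_add smooth_pd)

lemma dalembert_mult_left:
  fixes f :: "spacetime \<Rightarrow> real"
  shows "smooth f \<Longrightarrow> dalembert (\<lambda>x. c * f x) x = c * dalembert f x"
  by (simp add: dalembert_eq pd_mult_left smooth_pd algebra_simps
      smooth_bounded_linear[OF bounded_linear_mult_right])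

theorem lemma5p3:
  fixes n :: "spacetime \<Rightarrow> real" and E :: "spacetime \<Rightarrow> real ^ 2"
  assumes "smooth n" and "smooth E"
    and wave: "\<And>x. - dalembert n x = lap (\<lambda>y. (norm (E y))\<^sup>2) x"
    and klein_gordon: "\<And>x. - dalembert E x + E x = - (n x *\<^sub>R E x)"
  shows "- dalembert (n_tilde n E) x =
      1 / 2 * ((- dalembert (lap E) x + lap E x) \<bullet> E x)
    + 3 / 2 * (lap E x \<bullet> (- dalembert E x + E x))
    + 3 / 2 * (\<Sum>a\<in>roman. (- dalembert (pd_up a E) x + pd_up a E x) \<bullet> pd a E x)
    + 1 / 2 * (\<Sum>a\<in>roman. pd_up a E x \<bullet> (- dalembert (pd a E) x + pd a E x))
    - (\<Sum>a\<in>roman. \<Sum>\<beta>\<in>UNIV. Q a \<beta> (pd_up \<beta> (pd_up a E)) E x)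
    - (\<Sum>\<beta>\<in>UNIV. \<Sum>a\<in>roman. Q \<beta> a (pd_up a E) (pd_up \<beta> E) x)"
proof -
  define N where "N = (\<lambda>y. E y \<bullet> E y)"
  have N: "(\<lambda>y. (norm (E y))\<^sup>2) = N"
    by (simp add: N_def power2_norm_eq_inner)
  have smooth_N: "smooth N"
    unfolding N_def by (intro smooth_inner assms)
  have "n_tilde n E = (\<lambda>x. n x + 1 / 4 * lap N x)"
    by (simp add: fun_eq_iff n_tilde_def N)
  moreover have "smooth (\<lambda>x. 1 / 4 * lap N x)"
    by (intro smooth_bounded_linear[OF bounded_linear_mult_right] smooth_lap smooth_N)
  ultimately have lhs: "- dalembert (n_tilde n E) x = lap N x - 1 / 4 * dalembert (lap N) x"
    using dalembert_add[OF assms(1), of "\<lambda>x. 1 / 4 * lap N x" x]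
      dalembert_mult_left[OF smooth_lap[OF smooth_N], of "1 / 4" x] wave[of x]
    by (simp add: N)
  have lap_N: "lap N = (\<lambda>x. 2 * (pd 1 (pd 1 E) x \<bullet> E x + pd 2 (pd 2 E) x \<bullet> E x
      + pd 1 E x \<bullet> pd 1 E x + pd 2 E x \<bullet> pd 2 E x))"
    by (simp add: lap_eq N_def fun_eq_iff pd_inner pd_add assms smooth_pd smooth_inner inner_commute
        pd_mult_left)
  \<comment> \<open>Oriented so that smaller indices move outwards: as rewrite rules these bring
    every iterated derivative into a sorted normal form.\<close>
  have comm: "pd 1 (pd 0 f) = pd 0 (pd 1 f)" "pd 2 (pd 0 f) = pd 0 (pd 2 f)"
      "pd 2 (pd 1 f) = pd 1 (pd 2 f)" if "smooth f" for f :: "spacetime \<Rightarrow> real ^ 2"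
    using pd_commute[OF that] by auto
  \<comment> \<open>The simplifier collects equal vectors into \<open>2 * v\<close>, the componentwise product.\<close>
  have inner_2: "u \<bullet> (2 * v) = 2 * (u \<bullet> v)" for u v :: "real ^ 2"
    by (simp only: mult_2 inner_add_right)
  show ?thesis
    \<comment> \<open>The terms of the right-hand side without \<open>dalembert\<close> or
      \<open>Q\<close> have weights \<open>1/2 + 3/2 = 2\<close> and add up to \<open>lap N\<close>.
      In the rest, the null forms change the coefficient of
      \<open>\<Delta>E \<bullet> \<box>E\<close> from \<open>-3/2\<close> to \<open>-1/2\<close> and
      that of \<open>\<box>\<partial>\<^sup>a E \<bullet> \<partial>\<^sub>a E\<close> from
      \<open>-2\<close> to \<open>-1\<close>, as in
      \<open>- 1 / 4 * dalembert (lap N) x\<close>.\<close>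
    unfolding lhs lap_N
    by (simp add: pd_mult_left dalembert_eq lap_eq pd_inner pd_add pd_uminus pd_up_0 pd_up_1
        pd_up_2 Q_def sum_UNIV_3 assms smooth_pd smooth_add smooth_inner
        smooth_bounded_linear[OF bounded_linear_mult_right] comm inner_2
        inner_add_left inner_add_right inner_diff_left inner_diff_right algebra_simps inner_commute)
qed

end
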